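(* A displacement field $\mathbf{u}:\Omega\to\mathbb{R}^3$ is universal for the trigonal class $\mathbb{D}_4^v$ of linear strain-gradient elastic solids if and only if it is the superposition (sum) of a homogeneous displacement field and a field of the form $$\bigl(c_1x_2x_3+c_2x_1x_3,\; -c_2x_2x_3+c_3x_1x_3,\; g(x_1,x_2)\bigr),\qquad g(x_1,x_2)=d_1+d_2x_1+d_3x_2+d_4x_1x_2+d_5(x_2^2-x_1^2),$$ for some real constants $c_1,c_2,c_3,d_1,\dots,d_5$.
   Context: $\Omega\subset\mathbb{R}^3$ is a nonempty convex open set with Cartesian coordinates $(x_1,x_2,x_3)$ and orthonormal basis $e_1,e_2,e_3$. Repeated indices are summed over $1,2,3$ and a comma denotes partial differentiation. A displacement field is a smooth map $\mathbf{u}:\Omega\to\mathbb{R}^3$, with strain $e_{lm}=\tfrac12(u_{l,m}+u_{m,l})$. It is homogeneous if $\mathbf{u}(\mathbf{x})=\mathbf{H}\mathbf{x}+\mathbf{b}$ for a constant matrix $\mathbf{H}$ and constant vector $\mathbf{b}$. A strain-gradient material is a triple $(\mathsf{C},\mathsf{M},\mathsf{A})$ of constant real tensors of orders $4,5,6$ with index symmetries $\mathsf{C}_{ijlm}=\mathsf{C}_{jilm}=\mathsf{C}_{lmij}$, $\mathsf{M}_{ijklm}=\mathsf{M}_{jiklm}=\mathsf{M}_{ijlkm}$, $\mathsf{A}_{ijklmn}=\mathsf{A}_{jiklmn}=\mathsf{A}_{lmnijk}$. Its stress and hyper-stress are $\sigma_{ij}=\mathsf{C}_{ijlm}e_{lm}+\mathsf{M}_{ijlmn}e_{lm,n}$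 and $\tau_{ijk}=\mathsf{M}_{lmijk}e_{lm}+\mathsf{A}_{ijklmn}e_{lm,n}$, and the equilibrium equations without body forces are $\sigma_{ij,j}-\tau_{ijk,jk}=0$ in $\Omega$ for $i=1,2,3$. For a subgroup $G\subset \mathrm{O}(3)$, a tensor $T$ of order $p$ is $G$-invariant if $Q_{i_1j_1}\cdots Q_{i_pj_p}T_{j_1\dots j_p}=T_{i_1\dots i_p}$ for all $Q\in G$. Let $R$ be the rotation by $\pi/2$ about $e_3$. $\mathbb{D}_4$ is generated by $R$ and the rotation by $\pi$ about $e_1$; $\mathbb{D}_4^v$ is generated by $R$ and the reflection $x_1\mapsto -x_1$; $\mathbb{Z}_2^c=\{I,-I\}$, and $\mathbb{D}_4\oplus\mathbb{Z}_2^c$ is the group generated by $\mathbb{D}_4$ and $-I$. The class $\mathbb{D}_4^v$ (listed among the trigonal classes) is the set of all materials with $\mathsf{C}$ and $\mathsf{A}$ $\mathbb{D}_4\oplus\mathbb{Z}_2^c$-invariant (6 and 28 independent constants) and $\mathsf{M}$ $\mathbb{D}_4^v$-invariant (15 independent constants). A displacement field is universal for the class if it satisfies the equilibrium equations for every material in the class. *)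

theory Defs
  imports "HOL-Analysis.Analysis" "HOL-Algebra.Generated_Groups"
begin

section \<open>Displacement fields\<close>

text \<open>
  Cartesian coordinates are the components \<open>x $ 1\<close>, \<open>x $ 2\<close>, \<open>x $ 3\<close>
  of \<open>x :: real^3\<close>. Fields on an open set \<open>\<Omega>\<close> are total functions of which
  only the values on \<open>\<Omega>\<close> matter: all derivatives are evaluated at points of the open
  set \<open>\<Omega>\<close> and therefore depend only on the restriction to \<open>\<Omega>\<close>.
\<close>

definition partial :: "3 \<Rightarrow> (real^3 \<Rightarrow> real) \<Rightarrow> real^3 \<Rightarrow> real" where
  "partial k f x = deriv (\<lambda>t. f (x + t *\<^sub>R axis k 1)) 0"

text \<open>\<open>Ck_on k \<Omega> f\<close>: the function \<open>f\<close> is of class $C^k$ on the open set \<open>\<Omega>\<close>.\<close>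

fun Ck_on :: "nat \<Rightarrow> (real^3) set \<Rightarrow> (real^3 \<Rightarrow> real) \<Rightarrow> bool" where
  "Ck_on 0 \<Omega> f \<longleftrightarrow> continuous_on \<Omega> f"
| "Ck_on (Suc k) \<Omega> f \<longleftrightarrow> f differentiable_on \<Omega> \<and> (\<forall>i. Ck_on k \<Omega> (partial i f))"

definition displacement_field :: "(real^3) set \<Rightarrow> (real^3 \<Rightarrow> real^3) \<Rightarrow> bool" where
  "displacement_field \<Omega> u \<longleftrightarrow> (\<forall>k i. Ck_on k \<Omega> (\<lambda>x. u x $ i))"

definition homogeneous_field :: "(real^3) set \<Rightarrow> (real^3 \<Rightarrow> real^3) \<Rightarrow> bool" where
  "homogeneous_field \<Omega> u \<longleftrightarrow>
     (\<exists>(H :: real^3^3) (b :: real^3). \<forall>x\<in>\<Omega>. u x = H *v x + b)"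

definition strain :: "(real^3 \<Rightarrow> real^3) \<Rightarrow> 3 \<Rightarrow> 3 \<Rightarrow> real^3 \<Rightarrow> real" where
  "strain u l m x = (partial m (\<lambda>y. u y $ l) x + partial l (\<lambda>y. u y $ m) x) / 2"


section \<open>Strain-gradient materials\<close>

type_synonym tensor4 = "3 \<Rightarrow> 3 \<Rightarrow> 3 \<Rightarrow> 3 \<Rightarrow> real"
type_synonym tensor5 = "3 \<Rightarrow> 3 \<Rightarrow> 3 \<Rightarrow> 3 \<Rightarrow> 3 \<Rightarrow> real"
type_synonym tensor6 = "3 \<Rightarrow> 3 \<Rightarrow> 3 \<Rightarrow> 3 \<Rightarrow> 3 \<Rightarrow> 3 \<Rightarrow> real"

definition strain_gradient_material :: "tensor4 \<Rightarrow> tensor5 \<Rightarrow> tensor6 \<Rightarrow> bool" where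
  "strain_gradient_material C M A \<longleftrightarrow>
     (\<forall>i j l m. C i j l m = C j i l m \<and> C i j l m = C l m i j) \<and>
     (\<forall>i j k l m. M i j k l m = M j i k l m \<and> M i j k l m = M i j l k m) \<and>
     (\<forall>i j k l m n. A i j k l m n = A j i k l m n \<and> A i j k l m n = A l m n i j k)"

definition stress ::
  "tensor4 \<Rightarrow> tensor5 \<Rightarrow> (real^3 \<Rightarrow> real^3) \<Rightarrow> 3 \<Rightarrow> 3 \<Rightarrow> real^3 \<Rightarrow> real" where
  "stress C M u i j x =
     (\<Sum>l\<in>UNIV. \<Sum>m\<in>UNIV. C i j l m * strain u l m x) +
     (\<Sum>l\<in>UNIV. \<Sum>m\<in>UNIV. \<Sum>n\<in>UNIV. M i j l m n * partial n (strain u l m) x)"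

definition hyper_stress ::
  "tensor5 \<Rightarrow> tensor6 \<Rightarrow> (real^3 \<Rightarrow> real^3) \<Rightarrow> 3 \<Rightarrow> 3 \<Rightarrow> 3 \<Rightarrow> real^3 \<Rightarrow> real" where
  "hyper_stress M A u i j k x =
     (\<Sum>l\<in>UNIV. \<Sum>m\<in>UNIV. M l m i j k * strain u l m x) +
     (\<Sum>l\<in>UNIV. \<Sum>m\<in>UNIV. \<Sum>n\<in>UNIV. A i j k l m n * partial n (strain u l m) x)"

definition equilibrium ::
  "(real^3) set \<Rightarrow> tensor4 \<Rightarrow> tensor5 \<Rightarrow> tensor6 \<Rightarrow> (real^3 \<Rightarrow> real^3) \<Rightarrow> bool" where
  "equilibrium \<Omega> C M A u \<longleftrightarrow>
     (\<forall>x\<in>\<Omega>. \<forall>i.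
        (\<Sum>j\<in>UNIV. partial j (stress C M u i j) x) -
        (\<Sum>j\<in>UNIV. \<Sum>k\<in>UNIV. partial k (partial j (hyper_stress M A u i j k)) x) = 0)"


section \<open>Symmetry groups and invariance\<close>

definition O3 :: "(real^3^3) monoid" where
  "O3 = \<lparr>carrier = {Q. orthogonal_matrix Q}, mult = (**), one = mat 1\<rparr>"

definition rot1 :: "real \<Rightarrow> real^3^3" where
  "rot1 \<theta> = vector [vector [1, 0, 0],
                    vector [0, cos \<theta>, - sin \<theta>],
                    vector [0, sin \<theta>, cos \<theta>]]"

definition rot3 :: "real \<Rightarrow> real^3^3" where
  "rot3 \<theta> = vector [vector [cos \<theta>, - sin \<theta>, 0],
                    vector [sin \<theta>, cos \<theta>, 0],
                    vector [0, 0, 1]]"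

definition refl1 :: "real^3^3" where
  "refl1 = vector [vector [-1, 0, 0], vector [0, 1, 0], vector [0, 0, 1]]"

definition D4 :: "(real^3^3) set" where
  "D4 = generate O3 {rot3 (pi/2), rot1 pi}"

definition D4v :: "(real^3^3) set" where
  "D4v = generate O3 {rot3 (pi/2), refl1}"

definition Z2c :: "(real^3^3) set" where
  "Z2c = {mat 1, - mat 1}"

definition D4_Z2c :: "(real^3^3) set" where
  "D4_Z2c = generate O3 (D4 \<union> Z2c)"

definition invariant4 :: "(real^3^3) set \<Rightarrow> tensor4 \<Rightarrow> bool" where
  "invariant4 G T \<longleftrightarrow> (\<forall>Q\<in>G. \<forall>i j k l.
     (\<Sum>a\<in>UNIV. \<Sum>b\<in>UNIV. \<Sum>c\<in>UNIV. \<Sum>d\<in>UNIV.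
        Q $ i $ a * Q $ j $ b * Q $ k $ c * Q $ l $ d * T a b c d) = T i j k l)"

definition invariant5 :: "(real^3^3) set \<Rightarrow> tensor5 \<Rightarrow> bool" where
  "invariant5 G T \<longleftrightarrow> (\<forall>Q\<in>G. \<forall>i j k l m.
     (\<Sum>a\<in>UNIV. \<Sum>b\<in>UNIV. \<Sum>c\<in>UNIV. \<Sum>d\<in>UNIV. \<Sum>e\<in>UNIV.
        Q $ i $ a * Q $ j $ b * Q $ k $ c * Q $ l $ d * Q $ m $ e * T a b c d e) = T i j k l m)"

definition invariant6 :: "(real^3^3) set \<Rightarrow> tensor6 \<Rightarrow> bool" where
  "invariant6 G T \<longleftrightarrow> (\<forall>Q\<in>G. \<forall>i j k l m n.
     (\<Sum>a\<in>UNIV. \<Sum>b\<in>UNIV. \<Sum>c\<in>UNIV. \<Sum>d\<in>UNIV. \<Sum>e\<in>UNIV. \<Sum>f\<in>UNIV.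
        Q $ i $ a * Q $ j $ b * Q $ k $ c * Q $ l $ d * Q $ m $ e * Q $ n $ f * T a b c d e f)
     = T i j k l m n)"

lemma group_O3: "group O3"
proof (rule groupI)
  fix Q assume "Q \<in> carrier O3"
  then show "\<exists>P\<in>carrier O3. P \<otimes>\<^bsub>O3\<^esub> Q = \<one>\<^bsub>O3\<^esub>"
    by (intro bexI[of _ "transpose Q"]) (auto simp: O3_def orthogonal_matrix_def)
qed (auto simp: O3_def orthogonal_matrix_mul orthogonal_matrix_id matrix_mul_assoc)

lemma orthogonal_rot1: "orthogonal_matrix (rot1 \<theta>)"
  by (auto simp: orthogonal_matrix rot1_def vec_eq_iff forall_3 matrix_matrix_mult_def
        transpose_def mat_def sum_3 vector_3 power2_eq_square[symmetric])

lemma orthogonal_rot3: "orthogonal_matrix (rot3 \<theta>)"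
  by (auto simp: orthogonal_matrix rot3_def vec_eq_iff forall_3 matrix_matrix_mult_def
        transpose_def mat_def sum_3 vector_3 power2_eq_square[symmetric])

lemma orthogonal_refl1: "orthogonal_matrix refl1"
  by (auto simp: orthogonal_matrix refl1_def vec_eq_iff forall_3 matrix_matrix_mult_def
        transpose_def mat_def sum_3 vector_3)

lemma orthogonal_minus_id: "orthogonal_matrix (- mat 1 :: real^3^3)"
  by (auto simp: orthogonal_matrix vec_eq_iff forall_3 matrix_matrix_mult_def
        transpose_def mat_def sum_3)

lemma subgroup_D4: "subgroup D4 O3"
  unfolding D4_def
  by (rule group.generate_is_subgroup[OF group_O3])
     (auto simp: O3_def orthogonal_rot1 orthogonal_rot3)

lemma subgroup_D4v: "subgroup D4v O3"
  unfolding D4v_def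
  by (rule group.generate_is_subgroup[OF group_O3])
     (auto simp: O3_def orthogonal_refl1 orthogonal_rot3)

lemma subgroup_D4_Z2c: "subgroup D4_Z2c O3"
  unfolding D4_Z2c_def
  using subgroup.subset[OF subgroup_D4]
  by (intro group.generate_is_subgroup[OF group_O3])
     (auto simp: O3_def Z2c_def orthogonal_matrix_id orthogonal_minus_id)


section \<open>The class and its universal displacements\<close>

definition class_D4v :: "(tensor4 \<times> tensor5 \<times> tensor6) set" where
  "class_D4v = {(C, M, A). strain_gradient_material C M A \<and>
     invariant4 D4_Z2c C \<and> invariant5 D4v M \<and> invariant6 D4_Z2c A}"

definition universal ::
  "(tensor4 \<times> tensor5 \<times> tensor6) set \<Rightarrow> (real^3) set \<Rightarrow> (real^3 \<Rightarrow> real^3) \<Rightarrow> bool" where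
  "universal K \<Omega> u \<longleftrightarrow> (\<forall>(C, M, A)\<in>K. equilibrium \<Omega> C M A u)"

end

theory Submission
  imports Defs
begin

text \<open>
  The zero tensors are admissible, so the three tensors may be tested separately. The six constants
  of \<open>C\<close> already force most second partials of \<open>u\<close> to vanish: the first two components become
  quadratic and the third is, up to a multiple of \<open>x\<^sub>3\<close>, a plane harmonic function \<open>g(x\<^sub>1, x\<^sub>2)\<close>.
  The entries \<open>M\<^sub>1\<^sub>1\<^sub>1\<^sub>3\<^sub>1\<close> and \<open>M\<^sub>2\<^sub>2\<^sub>2\<^sub>3\<^sub>2\<close> of a \<open>D\<^sub>4\<^sup>v\<close>-invariant \<open>M\<close> then give \<open>g\<^sub>1\<^sub>1\<^sub>1 = g\<^sub>2\<^sub>2\<^sub>2 = 0\<close>, and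
  harmonicity kills the mixed third derivatives. Hence \<open>u\<close> is quadratic. Conversely, for quadratic
  \<open>u\<close> only \<open>C\<close> contributes to the equilibrium equations.
\<close>

section \<open>Partial derivatives\<close>

lemma has_derivative_along_axis:
  assumes "(f has_derivative D) (at (y + s *\<^sub>R axis k 1))"
  shows "((\<lambda>t. f (y + t *\<^sub>R axis k 1)) has_real_derivative D (axis k 1)) (at s)"
proof -
  have "((\<lambda>t. f (y + t *\<^sub>R axis k 1)) has_derivative (\<lambda>t. D (t *\<^sub>R axis k 1))) (at s)"
    using assms by (rule has_derivative_compose[rotated]) (auto intro!: derivative_eq_intros)
  moreover have "(\<lambda>t. D (t *\<^sub>R axis k 1)) = (*) (D (axis k 1))"
    using has_derivative_bounded_linear[OF assms] by (auto simp: linear_simps)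
  ultimately show ?thesis by (simp add: has_field_derivative_def)
qed

lemma has_derivative_axis_partial:
  assumes "(f has_derivative D) (at x)"
  shows "partial k f x = D (axis k 1)"
  using has_derivative_along_axis[of f D x 0 k] assms
  unfolding partial_def by (simp add: DERIV_imp_deriv)

text \<open>By linearity the derivative is determined by its values on the axis vectors, which are
  the partials. The sum and product rules for \<open>partial\<close> are read off this form.\<close>

lemma has_derivative_partial:
  assumes "f differentiable at x"
  shows "(f has_derivative (\<lambda>h. \<Sum>k\<in>UNIV. h $ k * partial k f x)) (at x)"
proof -
  obtain D where D: "(f has_derivative D) (at x)"
    using assms differentiable_def by blast
  have "D h = (\<Sum>k\<in>UNIV. h $ k * partial k f x)" for h
  proof -
    have "D h = D (\<Sum>k\<in>UNIV. h $ k *\<^sub>R axis k 1)"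
      by (simp add: basis_expansion flip: scalar_mult_eq_scaleR)
    also have "\<dots> = (\<Sum>k\<in>UNIV. h $ k * D (axis k 1))"
      using has_derivative_linear[OF D] by (simp add: linear_sum linear_cmul)
    finally show ?thesis by (simp add: has_derivative_axis_partial[OF D])
  qed
  then show ?thesis using D by presburger
qed

text \<open>The parameter \<open>s\<close> is arbitrary rather than 0, so that the mean value
  theorem applies along a whole segment.\<close>

lemma DERIV_along_axis:
  assumes "f differentiable at (y + s *\<^sub>R axis k 1)"
  shows "((\<lambda>t. f (y + t *\<^sub>R axis k 1)) has_real_derivative partial k f (y + s *\<^sub>R axis k 1)) (at s)"
  using assms has_derivative_along_axis has_derivative_axis_partial
  unfolding differentiable_def by fastforce

lemma sum_axis_mult:
  fixes f :: "'n::finite \<Rightarrow> real"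
  shows "(\<Sum>m\<in>UNIV. axis k 1 $ m * f m) = f k"
proof -
  have "(\<Sum>m\<in>UNIV. axis k 1 $ m * f m) = (\<Sum>m\<in>UNIV. if m = k then f m else 0)"
    by (rule sum.cong) (auto simp: axis_def)
  then show ?thesis by simp
qed

text \<open>A short piece of the axis line through \<open>x\<close> stays in the open set, so
  \<open>partial\<close> sees only values there. Identities known only on \<Omega> can therefore be
  differentiated.\<close>

lemma partial_cong:
  assumes "open \<Omega>" "x \<in> \<Omega>" "\<And>y. y \<in> \<Omega> \<Longrightarrow> f y = g y"
  shows "partial k f x = partial k g x"
proof -
  have "((\<lambda>t. x + t *\<^sub>R axis k 1) \<longlongrightarrow> x + 0 *\<^sub>R axis k 1) (nhds (0::real))"
    by (intro tendsto_intros filterlim_ident)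
  then have "\<forall>\<^sub>F t in nhds (0::real). x + t *\<^sub>R axis k 1 \<in> \<Omega>"
    using assms(1,2) by (simp add: topological_tendstoD)
  then have "\<forall>\<^sub>F t in nhds (0::real). f (x + t *\<^sub>R axis k 1) = g (x + t *\<^sub>R axis k 1)"
    by eventually_elim (rule assms(3))
  then show ?thesis
    unfolding partial_def by (rule deriv_cong_ev) simp
qed

lemma partial_const [simp]: "partial k (\<lambda>x. c) = (\<lambda>x. 0)"
  by (simp add: partial_def fun_eq_iff)

lemma partial_add:
  assumes "f differentiable at x" "g differentiable at x"
  shows "partial k (\<lambda>x. f x + g x) x = partial k f x + partial k g x"
  using has_derivative_axis_partial[OF has_derivative_add[OF assms[THEN has_derivative_partial]]]
  by (simp add: sum_axis_mult)

lemma partial_cmult: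
  fixes c :: real
  assumes "f differentiable at x"
  shows "partial k (\<lambda>x. c * f x) x = c * partial k f x"
  using has_derivative_axis_partial[OF has_derivative_mult_right[OF has_derivative_partial[OF assms]]]
  by (simp add: sum_axis_mult)

lemma partial_sum:
  assumes "finite I" "\<And>i. i \<in> I \<Longrightarrow> f i differentiable at x"
  shows "partial k (\<lambda>x. \<Sum>i\<in>I. f i x) x = (\<Sum>i\<in>I. partial k (f i) x)"
proof -
  have "((\<lambda>x. \<Sum>i\<in>I. f i x) has_derivative
      (\<lambda>h. \<Sum>i\<in>I. \<Sum>k\<in>UNIV. h $ k * partial k (f i) x)) (at x)"
    using assms by (intro has_derivative_sum has_derivative_partial) auto
  from has_derivative_axis_partial[OF this] show ?thesis
    by (simp add: sum_axis_mult)
qed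

section \<open>Smooth functions and the symmetry of second partials\<close>

definition smooth :: "(real^3) set \<Rightarrow> (real^3 \<Rightarrow> real) \<Rightarrow> bool" where
  "smooth \<Omega> f \<longleftrightarrow> (\<forall>k. Ck_on k \<Omega> f)"

text \<open>Taking a partial lowers the order by one; quantifying over all orders absorbs this
  loss.\<close>

lemma smooth_partial: "smooth \<Omega> f \<Longrightarrow> smooth \<Omega> (partial i f)"
  unfolding smooth_def by (metis Ck_on.simps(2))

lemma smooth_continuous: "smooth \<Omega> f \<Longrightarrow> continuous_on \<Omega> f"
  unfolding smooth_def by (metis Ck_on.simps(1))

lemma smooth_differentiable:
  assumes "smooth \<Omega> f" "open \<Omega>" "x \<in> \<Omega>"
  shows "f differentiable at x"
proof -
  have "Ck_on (Suc 0) \<Omega> f" using assms(1) unfolding smooth_def by blast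
  then show ?thesis using assms(2,3) differentiable_on_eq_differentiable_at by auto
qed

text \<open>
  The second difference on the left is symmetric in \<open>i\<close> and \<open>j\<close>, which yields Schwarz's theorem in the
  limit \<open>h \<rightarrow> 0\<close>.
\<close>

lemma double_difference:
  assumes f: "smooth \<Omega> f" and "open \<Omega>" and h: "0 < h" and ball: "ball x (3 * h) \<subseteq> \<Omega>"
  obtains y where "dist y x < 3 * h"
    and "f (x + h *\<^sub>R axis i 1 + h *\<^sub>R axis j 1) - f (x + h *\<^sub>R axis i 1)
          - f (x + h *\<^sub>R axis j 1) + f x = h * h * partial j (partial i f) y"
proof -
  \<comment> \<open>Two steps of length at most \<open>h\<close> move the point by at most
    \<open>2 * h\<close>, strictly inside the radius \<open>3 * h\<close>.\<close>
  have inb: "dist (x + s *\<^sub>R axis i 1 + t *\<^sub>R axis j 1) x < 3 * h"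
    if "0 \<le> s" "s \<le> h" "0 \<le> t" "t \<le> h" for s t
  proof -
    have "norm (s *\<^sub>R axis i 1 + t *\<^sub>R axis j (1::real)) \<le> s + t"
      using that by (intro order.trans[OF norm_triangle_ineq]) simp
    then have "norm (s *\<^sub>R axis i 1 + t *\<^sub>R axis j (1::real)) < 3 * h" using that h by linarith
    then show ?thesis by (simp add: dist_norm add.assoc)
  qed
  have inO: "x + s *\<^sub>R axis i 1 + t *\<^sub>R axis j 1 \<in> \<Omega>"
    if "0 \<le> s" "s \<le> h" "0 \<le> t" "t \<le> h" for s t
    using inb[OF that] ball by (auto simp: dist_commute subset_iff)
  note diff = smooth_differentiable[OF _ \<open>open \<Omega>\<close> inO]
  \<comment> \<open>The mean value theorem is used twice: on \<open>F\<close>, the difference in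
    direction \<open>j\<close> seen as a function along direction \<open>i\<close>, and then on
    \<open>partial i f\<close> along direction \<open>j\<close>.\<close>
  define F where "F s = f (x + h *\<^sub>R axis j 1 + s *\<^sub>R axis i 1) - f (x + s *\<^sub>R axis i 1)" for s
  have "DERIV F s :> partial i f (x + h *\<^sub>R axis j 1 + s *\<^sub>R axis i 1) - partial i f (x + s *\<^sub>R axis i 1)"
    if "0 \<le> s" "s \<le> h" for s
    unfolding F_def
    using diff[OF f that, of h] diff[OF f that, of 0] h
    by (intro DERIV_diff DERIV_along_axis) (simp_all add: add_ac)
  from MVT2[OF h this] obtain s where s: "0 < s" "s < h" "F h - F 0 = (h - 0) *
      (partial i f (x + h *\<^sub>R axis j 1 + s *\<^sub>R axis i 1) - partial i f (x + s *\<^sub>R axis i 1))"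
    by blast
  have "((\<lambda>t. partial i f (x + s *\<^sub>R axis i 1 + t *\<^sub>R axis j 1)) has_real_derivative
      partial j (partial i f) (x + s *\<^sub>R axis i 1 + t *\<^sub>R axis j 1)) (at t)" if "0 \<le> t" "t \<le> h" for t
    using diff[OF smooth_partial[OF f]] that s by (intro DERIV_along_axis) simp
  from MVT2[OF h this] obtain t where t: "0 < t" "t < h" 
      "partial i f (x + s *\<^sub>R axis i 1 + h *\<^sub>R axis j 1) - partial i f (x + s *\<^sub>R axis i 1 + 0 *\<^sub>R axis j 1)
       = (h - 0) * partial j (partial i f) (x + s *\<^sub>R axis i 1 + t *\<^sub>R axis j 1)"
    by blast
  show thesis
  proof (rule that)
    show "dist (x + s *\<^sub>R axis i 1 + t *\<^sub>R axis j 1) x < 3 * h"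
      using inb s t by simp
    show "f (x + h *\<^sub>R axis i 1 + h *\<^sub>R axis j 1) - f (x + h *\<^sub>R axis i 1)
          - f (x + h *\<^sub>R axis j 1) + f x
          = h * h * partial j (partial i f) (x + s *\<^sub>R axis i 1 + t *\<^sub>R axis j 1)"
      using s(3) t(3) by (simp add: F_def add_ac)
  qed
qed

text \<open>Evaluating the same second difference in both orders equates the two mixed partials at
  two possibly different points within \<open>3 * h n\<close> of \<open>x\<close>. Both points tend
  to \<open>x\<close>, and second partials are continuous.\<close>

theorem partial_commute:
  assumes f: "smooth \<Omega> f" and "open \<Omega>" and x: "x \<in> \<Omega>"
  shows "partial i (partial j f) x = partial j (partial i f) x"
proof -
  obtain r where r: "r > 0" "ball x r \<subseteq> \<Omega>" using \<open>open \<Omega>\<close> x openE by blast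
  define h where "h n = r / (3 * real (Suc n))" for n
  have h: "h n > 0" "ball x (3 * h n) \<subseteq> \<Omega>" for n
  proof -
    show "h n > 0" using r by (simp add: h_def)
    have "3 * h n \<le> r" using r by (simp add: h_def field_simps)
    then show "ball x (3 * h n) \<subseteq> \<Omega>" using r(2) subset_ball by blast
  qed
  have h0: "(\<lambda>n. 3 * h n) \<longlonglongrightarrow> 0"
  proof -
    have "(\<lambda>n. r * inverse (real (Suc n))) \<longlonglongrightarrow> 0"
      using tendsto_mult_left[OF LIMSEQ_inverse_real_of_nat, of r] by simp
    moreover have "(\<lambda>n. 3 * h n) = (\<lambda>n. r * inverse (real (Suc n)))"
      by (auto simp: h_def field_simps)
    ultimately show ?thesis by simp
  qed
  have "\<forall>n. \<exists>y z. dist y x < 3 * h n \<and> dist z x < 3 * h n \<and>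
      partial i (partial j f) y = partial j (partial i f) z"
  proof
    fix n
    obtain z where z: "dist z x < 3 * h n" "f (x + h n *\<^sub>R axis i 1 + h n *\<^sub>R axis j 1)
        - f (x + h n *\<^sub>R axis i 1) - f (x + h n *\<^sub>R axis j 1) + f x
        = h n * h n * partial j (partial i f) z"
      using double_difference[OF f \<open>open \<Omega>\<close> h] .
    obtain y where y: "dist y x < 3 * h n" "f (x + h n *\<^sub>R axis j 1 + h n *\<^sub>R axis i 1)
        - f (x + h n *\<^sub>R axis j 1) - f (x + h n *\<^sub>R axis i 1) + f x
        = h n * h n * partial i (partial j f) y"
      using double_difference[OF f \<open>open \<Omega>\<close> h] .
    have "h n * h n * partial i (partial j f) y = h n * h n * partial j (partial i f) z"
      unfolding z(2)[symmetric] y(2)[symmetric]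
      by (simp add: add.assoc add.commute[of "h n *\<^sub>R axis i 1"])
    then have "partial i (partial j f) y = partial j (partial i f) z" using h(1)[of n] by simp
    then show "\<exists>y z. dist y x < 3 * h n \<and> dist z x < 3 * h n \<and>
      partial i (partial j f) y = partial j (partial i f) z" using y z by blast
  qed
  then obtain y z where yz: "\<And>n. dist (y n) x < 3 * h n" "\<And>n. dist (z n) x < 3 * h n"
      "\<And>n. partial i (partial j f) (y n) = partial j (partial i f) (z n)"
    by metis
  have lim: "w \<longlonglongrightarrow> x" if "\<And>n. dist (w n) x < 3 * h n" for w
    by (rule metric_tendsto_imp_tendsto[OF h0]) 
      (use that h(1) in \<open>auto intro!: always_eventually less_imp_le simp: less_imp_le\<close>)
  have cont: "isCont (partial a (partial b f)) x" for a b
    using smooth_continuous[OF smooth_partial[OF smooth_partial[OF f]]] \<open>open \<Omega>\<close> x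
    by (simp add: continuous_on_eq_continuous_at)
  have "(\<lambda>n. partial i (partial j f) (y n)) \<longlonglongrightarrow> partial i (partial j f) x"
    using isCont_tendsto_compose[OF cont lim[OF yz(1)]] .
  moreover have "(\<lambda>n. partial i (partial j f) (y n)) \<longlonglongrightarrow> partial j (partial i f) x"
    using isCont_tendsto_compose[OF cont lim[OF yz(2)]] by (simp add: yz(3))
  ultimately show ?thesis by (rule LIMSEQ_unique)
qed

section \<open>Recovering a function from its partials\<close>

lemma eq_up_to_constant_if_partials_eq:
  assumes "open \<Omega>" "convex \<Omega>"
    and "\<And>x. x \<in> \<Omega> \<Longrightarrow> f differentiable at x" "\<And>x. x \<in> \<Omega> \<Longrightarrow> g differentiable at x"
    and "\<And>i x. x \<in> \<Omega> \<Longrightarrow> partial i f x = partial i g x"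
  shows "\<exists>c. \<forall>x\<in>\<Omega>. f x = c + g x"
proof -
  have "((\<lambda>x. f x - g x) has_derivative (\<lambda>h. 0)) (at x within \<Omega>)" if "x \<in> \<Omega>" for x
    using has_derivative_diff[OF has_derivative_partial[OF assms(3)[OF that]]
        has_derivative_partial[OF assms(4)[OF that]]]
    by (simp add: assms(5)[OF that] has_derivative_at_withinI)
  \<comment> \<open>Convexity of \<Omega> enters here: the derivative of the difference vanishes
    along every segment in \<Omega>.\<close>
  from has_derivative_zero_constant[OF assms(2) this] obtain c where "\<forall>x\<in>\<Omega>. f x - g x = c" by blast
  then show ?thesis by (intro exI[of _ c]) (simp add: algebra_simps)
qed

lemmas has_derivative_vec_nth = bounded_linear_imp_has_derivative[OF bounded_linear_vec_nth]

lemma has_derivative_linear_form: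
  fixes a :: "3 \<Rightarrow> real"
  shows "((\<lambda>y. \<Sum>n\<in>UNIV. a n * y $ n) has_derivative (\<lambda>y. \<Sum>n\<in>UNIV. a n * y $ n)) (at x)"
  by (intro has_derivative_sum has_derivative_mult_right has_derivative_vec_nth)

lemma partial_affine:
  fixes a :: "3 \<Rightarrow> real"
  assumes "open \<Omega>" "x \<in> \<Omega>" "\<And>y. y \<in> \<Omega> \<Longrightarrow> f y = c + (\<Sum>n\<in>UNIV. a n * y $ n)"
  shows "partial k f x = a k"
proof -
  have "((\<lambda>y. c + (\<Sum>n\<in>UNIV. a n * y $ n)) has_derivative (\<lambda>y. \<Sum>n\<in>UNIV. a n * y $ n)) (at x)"
    using has_derivative_add[OF has_derivative_const has_derivative_linear_form] by simp
  from has_derivative_axis_partial[OF this] show ?thesis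
    using partial_cong[OF assms] by (simp add: sum_axis_mult mult.commute[of "a _"])
qed

text \<open>The division by 2 makes a symmetric \<open>q\<close> the Hessian; \<open>b\<close> is
  the gradient at the origin.\<close>

definition quadratic :: "real \<Rightarrow> (3 \<Rightarrow> real) \<Rightarrow> (3 \<Rightarrow> 3 \<Rightarrow> real) \<Rightarrow> real^3 \<Rightarrow> real" where
  "quadratic d b q x = d + (\<Sum>m\<in>UNIV. b m * x $ m) + (\<Sum>m\<in>UNIV. \<Sum>n\<in>UNIV. q m n * (x $ m * x $ n)) / 2"

lemma has_derivative_quadratic:
  assumes "\<And>m n. q m n = q n m"
  shows "(quadratic d b q has_derivative (\<lambda>h. \<Sum>m\<in>UNIV. (b m + (\<Sum>n\<in>UNIV. q m n * x $ n)) * h $ m)) (at x)"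
proof -
  have "q 2 1 = q 1 2" "q 3 1 = q 1 3" "q 3 2 = q 2 3" by (rule assms)+
  then show ?thesis
    unfolding quadratic_def sum_3
    by (auto intro!: derivative_eq_intros has_derivative_vec_nth simp: fun_eq_iff) (simp add: algebra_simps)
qed

lemma partial_quadratic:
  assumes "\<And>m n. q m n = q n m"
  shows "partial m (quadratic d b q) x = b m + (\<Sum>n\<in>UNIV. q m n * x $ n)"
  using has_derivative_axis_partial[OF has_derivative_quadratic[OF assms]]
  by (simp add: sum_axis_mult mult.commute[of "b _ + _"])

text \<open>Integration in three stages: the second partials are constant, hence the first partials
  are affine, hence the function is quadratic. Each stage compares with an explicit function having
  the same partials.\<close>

lemma quadratic_if_third_partials_zero:
  assumes f: "smooth \<Omega> f" and \<Omega>: "open \<Omega>" "convex \<Omega>" "x0 \<in> \<Omega>"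
    and third: "\<And>i j k x. x \<in> \<Omega> \<Longrightarrow> partial i (partial j (partial k f)) x = 0"
  obtains d b where
    "\<And>x. x \<in> \<Omega> \<Longrightarrow> f x = quadratic d b (\<lambda>m n. partial m (partial n f) x0) x"
proof -
  note sm = smooth_partial[OF f] smooth_partial[OF smooth_partial[OF f]]
  note df = smooth_differentiable[OF _ \<Omega>(1)]
  define q where "q m n = partial m (partial n f) x0" for m n
  have qsym: "q m n = q n m" for m n
    unfolding q_def by (rule partial_commute[OF f \<Omega>(1,3)])
  have q: "partial m (partial n f) x = q m n" if "x \<in> \<Omega>" for m n x
  proof -
    \<comment> \<open>The summand 0 is the comparison function.\<close>
    have "\<exists>c. \<forall>y\<in>\<Omega>. partial m (partial n f) y = c + 0"
      by (rule eq_up_to_constant_if_partials_eq[OF \<Omega>(1,2)]) (simp_all add: third df sm)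
    then obtain c where c: "\<And>y. y \<in> \<Omega> \<Longrightarrow> partial m (partial n f) y = c" by auto
    show ?thesis using c[OF that] c[OF \<Omega>(3)] by (simp add: q_def)
  qed
  have "\<exists>b. \<forall>x\<in>\<Omega>. partial m f x = b + (\<Sum>n\<in>UNIV. q m n * x $ n)" for m
  proof -
    have "partial i (partial m f) x = partial i (\<lambda>x. \<Sum>n\<in>UNIV. q m n * x $ n) x" if "x \<in> \<Omega>" for i x
      using partial_affine[OF \<Omega>(1) that, of "\<lambda>x. \<Sum>n\<in>UNIV. q m n * x $ n" 0 "q m" i]
      by (simp add: q[OF that] qsym)
    moreover have "(\<lambda>x. \<Sum>n\<in>UNIV. q m n * x $ n) differentiable at x" for x :: "real^3"
      unfolding differentiable_def
      by (rule exI) (rule has_derivative_linear_form)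
    ultimately show ?thesis
      by (intro eq_up_to_constant_if_partials_eq[OF \<Omega>(1,2)]) (simp_all add: df sm)
  qed
  then obtain b where b: "\<And>m x. x \<in> \<Omega> \<Longrightarrow> partial m f x = b m + (\<Sum>n\<in>UNIV. q m n * x $ n)"
    by metis
  moreover have "quadratic 0 b q differentiable at x" for x
    using has_derivative_quadratic[of q, OF qsym] unfolding differentiable_def by blast
  ultimately have "\<exists>d. \<forall>x\<in>\<Omega>. f x = d + quadratic 0 b q x"
    by (intro eq_up_to_constant_if_partials_eq[OF \<Omega>(1,2)])
      (simp_all add: df f partial_quadratic[of q, OF qsym])
  then obtain d where d: "\<And>x. x \<in> \<Omega> \<Longrightarrow> f x = d + quadratic 0 b q x" by blast
  show thesis
    by (rule that[of d b]) (simp add: d quadratic_def q_def)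
qed

section \<open>Signed permutation matrices fixing the third axis\<close>

text \<open>The matrix maps \<open>x\<close> to the vector with components
  \<open>s i * x $ p i\<close>. One nonzero entry per row makes every invariance sum collapse to a
  single term.\<close>

definition signed_perm :: "(3 \<Rightarrow> real) \<Rightarrow> (3 \<Rightarrow> 3) \<Rightarrow> real^3^3" where
  "signed_perm s p = (\<chi> i j. if j = p i then s i else 0)"

text \<open>With \<open>up\<close> the third axis keeps its direction, as it does in
  \<open>D4v\<close>; \<open>D4_Z2c\<close> contains elements that reverse it.\<close>

definition signed_perms :: "bool \<Rightarrow> (real^3^3) set" where
  "signed_perms up = {signed_perm s p | s p.
     (\<forall>i. s i = 1 \<or> s i = -1) \<and> bij p \<and> p 3 = 3 \<and> (up \<longrightarrow> s 3 = 1)}"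

lemma mult_delta:
  fixes x y :: real
  shows "x * (if P then y else 0) = (if P then x * y else 0)"
    and "(if P then y else 0) * x = (if P then y * x else 0)"
  by simp_all

lemma sum_if_const: "(\<Sum>a\<in>A. if P then f a else (0::real)) = (if P then \<Sum>a\<in>A. f a else 0)"
  by simp

lemma signed_permsI:
  assumes "\<And>i. s i = 1 \<or> s i = -1" "bij p" "p 3 = 3" "up \<Longrightarrow> s 3 = 1"
  shows "signed_perm s p \<in> signed_perms up"
  using assms unfolding signed_perms_def by blast

text \<open>Row \<open>i\<close> of the product is \<open>s i\<close> times row \<open>p i\<close>
  of the second factor, which is why the permutations compose in reverse order.\<close>

lemma signed_perm_mult:
  "signed_perm s p ** signed_perm t r = signed_perm (\<lambda>i. s i * t (p i)) (r \<circ> p)"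
proof -
  have "(\<Sum>k\<in>UNIV. (if k = c then x else 0) * f k) = x * f c" for c :: 3 and x :: real and f
    by (simp add: mult_delta)
  then show ?thesis by (simp add: signed_perm_def matrix_matrix_mult_def vec_eq_iff)
qed

lemma transpose_signed_perm:
  assumes "bij p"
  shows "transpose (signed_perm s p) = signed_perm (s \<circ> inv_into UNIV p) (inv_into UNIV p)"
  using assms by (auto simp: signed_perm_def transpose_def vec_eq_iff bij_is_inj bij_is_surj surj_f_inv_f)

lemma signed_perm_one: "signed_perm (\<lambda>i. 1) id = mat 1"
  by (auto simp: signed_perm_def mat_def vec_eq_iff)

lemma orthogonal_signed_perm:
  assumes "\<And>i. s i = 1 \<or> s i = -1" "bij p"
  shows "orthogonal_matrix (signed_perm s p)"
proof -
  have sq: "s i * s i = 1" for i using assms(1)[of i] by auto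
  have "signed_perm (s \<circ> inv_into UNIV p) (inv_into UNIV p) ** signed_perm s p = signed_perm (\<lambda>i. 1) id"
    unfolding signed_perm_mult using assms(2) 
    by (intro arg_cong2[of _ _ _ _ signed_perm]) (auto simp: fun_eq_iff bij_is_surj surj_f_inv_f sq)
  then show ?thesis
    by (simp add: orthogonal_matrix transpose_signed_perm[OF assms(2)] signed_perm_one)
qed

text \<open>A subgroup containing the generators contains the generated group. Invariance of the
  test tensors can then be checked on an arbitrary signed permutation, without listing group
  elements.\<close>

lemma subgroup_signed_perms: "subgroup (signed_perms up) O3"
proof (rule group.subgroupI[OF group_O3])
  show sub: "signed_perms up \<subseteq> carrier O3"
    by (auto simp: signed_perms_def O3_def orthogonal_signed_perm)
  have "mat 1 \<in> signed_perms up"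
    unfolding signed_perms_def
    by (rule CollectI, rule exI[of _ "\<lambda>i. 1"], rule exI[of _ id]) (simp add: signed_perm_one)
  then show "signed_perms up \<noteq> {}" by blast
  fix Q assume Q: "Q \<in> signed_perms up"
  then obtain s p where sp: "Q = signed_perm s p" "\<And>i. s i = 1 \<or> s i = -1" "bij p" "p 3 = 3"
      "up \<Longrightarrow> s 3 = 1"
    by (auto simp: signed_perms_def)
  have "transpose Q ** Q = mat 1" "orthogonal_matrix (transpose Q)"
    using orthogonal_signed_perm[of s p] sp by (simp_all add: orthogonal_matrix_def)
  then have "inv\<^bsub>O3\<^esub> Q = transpose Q"
    using sub Q by (intro group.inv_equality[OF group_O3]) (auto simp: O3_def)
  moreover have "inv_into UNIV p 3 = 3" using sp by (metis bij_is_inj inv_f_f)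
  ultimately show "inv\<^bsub>O3\<^esub> Q \<in> signed_perms up"
    using sp by (simp add: transpose_signed_perm) (rule signed_permsI; simp add: bij_imp_bij_inv)
  fix P assume "P \<in> signed_perms up"
  then obtain t r where tr: "P = signed_perm t r" "\<And>i. t i = 1 \<or> t i = -1" "bij r" "r 3 = 3"
      "up \<Longrightarrow> t 3 = 1"
    by (auto simp: signed_perms_def)
  have "s i * t (p i) = 1 \<or> s i * t (p i) = -1" for i
    using sp(2)[of i] tr(2)[of "p i"] by auto
  then show "Q \<otimes>\<^bsub>O3\<^esub> P \<in> signed_perms up"
    using sp tr by (simp add: O3_def signed_perm_mult) (rule signed_permsI; simp add: bij_comp)
qed

definition swap12 :: "3 \<Rightarrow> 3" where
  "swap12 i = (if i = 1 then 2 else if i = 2 then 1 else 3)"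

lemma bij_swap12: "bij swap12"
proof (rule o_bij)
  show "swap12 \<circ> swap12 = id" "swap12 \<circ> swap12 = id"
    using exhaust_3 by (auto simp: swap12_def fun_eq_iff)
qed

definition signs :: "real \<Rightarrow> real \<Rightarrow> real \<Rightarrow> 3 \<Rightarrow> real" where
  "signs x y z i = (if i = 1 then x else if i = 2 then y else z)"

section \<open>The generators as signed permutations\<close>

lemma rot3_signed_perm: "rot3 (pi/2) = signed_perm (signs (-1) 1 1) swap12"
  by (auto simp: rot3_def signed_perm_def swap12_def signs_def vec_eq_iff forall_3)

lemma rot1_signed_perm: "rot1 pi = signed_perm (signs 1 (-1) (-1)) id"
  by (auto simp: rot1_def signed_perm_def signs_def vec_eq_iff forall_3)

lemma refl1_signed_perm: "refl1 = signed_perm (signs (-1) 1 1) id"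
  by (auto simp: refl1_def signed_perm_def signs_def vec_eq_iff forall_3)

lemma minus_one_signed_perm: "- mat 1 = signed_perm (\<lambda>i. -1) id"
  by (auto simp: signed_perm_def mat_def vec_eq_iff)

lemma D4v_subset: "D4v \<subseteq> signed_perms True"
  unfolding D4v_def
  by (rule group.generate_subgroup_incl[OF group_O3 _ subgroup_signed_perms])
    (auto simp: rot3_signed_perm refl1_signed_perm signs_def bij_swap12 swap12_def
      intro!: signed_permsI split: if_splits)

lemma D4_Z2c_subset: "D4_Z2c \<subseteq> signed_perms False"
proof -
  have "D4 \<subseteq> signed_perms False"
    unfolding D4_def
    by (rule group.generate_subgroup_incl[OF group_O3 _ subgroup_signed_perms])
      (auto simp: rot3_signed_perm rot1_signed_perm signs_def bij_swap12 swap12_def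
        intro!: signed_permsI split: if_splits)
  moreover have "Z2c \<subseteq> signed_perms False"
    using signed_permsI[of "\<lambda>i. 1" id False] signed_permsI[of "\<lambda>i. -1" id False]
    by (simp add: Z2c_def minus_one_signed_perm signed_perm_one)
  ultimately show ?thesis
    unfolding D4_Z2c_def
    by (intro group.generate_subgroup_incl[OF group_O3 _ subgroup_signed_perms]) auto
qed

text \<open>For a given invariant \<open>C\<close>, all the relations used later come from this
  element and \<open>rot1 pi\<close>.\<close>

lemma rot3_in_D4_Z2c: "rot3 (pi/2) \<in> D4_Z2c"
  unfolding D4_Z2c_def D4_def by (intro generate.incl UnI1) simp

lemma rot1_in_D4_Z2c: "rot1 pi \<in> D4_Z2c"
  unfolding D4_Z2c_def D4_def by (intro generate.incl UnI1) simp

lemma signed_perm_sum4: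
  "(\<Sum>a\<in>UNIV. \<Sum>b\<in>UNIV. \<Sum>c\<in>UNIV. \<Sum>d\<in>UNIV.
      signed_perm s p $ i $ a * signed_perm s p $ j $ b * signed_perm s p $ k $ c *
      signed_perm s p $ l $ d * T a b c d) =
    s i * s j * s k * s l * T (p i) (p j) (p k) (p l)"
  by (simp add: signed_perm_def mult_delta sum_if_const)

lemma signed_perm_sum5:
  "(\<Sum>a\<in>UNIV. \<Sum>b\<in>UNIV. \<Sum>c\<in>UNIV. \<Sum>d\<in>UNIV. \<Sum>e\<in>UNIV.
      signed_perm s p $ i $ a * signed_perm s p $ j $ b * signed_perm s p $ k $ c *
      signed_perm s p $ l $ d * signed_perm s p $ m $ e * T a b c d e) =
    s i * s j * s k * s l * s m * T (p i) (p j) (p k) (p l) (p m)"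
  by (simp add: signed_perm_def mult_delta sum_if_const)

section \<open>Test materials\<close>

text \<open>
  With \<open>a\<close> and \<open>b\<close> unchanged by exchanging the axes 1 and 2, this covers the six constants of the class
  (\<open>b 1 1\<close> and \<open>b 3 3\<close> only shift \<open>a 1 1\<close> and \<open>a 3 3\<close>).
\<close>

definition tetragonal_stiffness :: "(3 \<Rightarrow> 3 \<Rightarrow> real) \<Rightarrow> (3 \<Rightarrow> 3 \<Rightarrow> real) \<Rightarrow> tensor4" where
  "tetragonal_stiffness a b i j l m = of_bool (i = j \<and> l = m) * a i l
     + (of_bool (i = l \<and> j = m) + of_bool (i = m \<and> j = l)) * b i j"

text \<open>The bijections fixing 3 are the identity and the exchange of 1 and 2, so four values
  remain free: those at (1,1), (1,2), (1,3) and (3,3). Quantifying over \<open>p\<close> matches the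
  form of the signed permutations.\<close>

definition axial_symmetric :: "(3 \<Rightarrow> 3 \<Rightarrow> real) \<Rightarrow> bool" where
  "axial_symmetric a \<longleftrightarrow> (\<forall>i j. a i j = a j i) \<and>
     (\<forall>p i j. bij p \<longrightarrow> p 3 = 3 \<longrightarrow> a (p i) (p j) = a i j)"

text \<open>Each nonzero entry has one index 3 and four equal indices from 1 and 2. A signed
  permutation therefore multiplies it by \<open>s 3\<close>, so it survives in \<open>D4v\<close>
  but changes sign under inversion.\<close>

definition polar_coupling :: tensor5 where
  "polar_coupling i j k l m =
     of_bool (i = j \<and> j = m \<and> i \<noteq> 3 \<and> (k = 3 \<and> l = i \<or> k = i \<and> l = 3))"

lemma axial_symmetricD:
  assumes "axial_symmetric a"
  shows "a i j = a j i" and "bij p \<Longrightarrow> p 3 = 3 \<Longrightarrow> a (p i) (p j) = a i j"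
proof -
  note * = assms[unfolded axial_symmetric_def]
  show "a i j = a j i" using conjunct1[OF *] by blast
  show "bij p \<Longrightarrow> p 3 = 3 \<Longrightarrow> a (p i) (p j) = a i j" using conjunct2[OF *] by blast
qed

lemma tetragonal_stiffness_in_class:
  assumes "axial_symmetric a" "axial_symmetric b"
  shows "(tetragonal_stiffness a b, \<lambda>_ _ _ _ _. 0, \<lambda>_ _ _ _ _ _. 0) \<in> class_D4v"
proof -
  note a = axial_symmetricD(1)[OF assms(1)] and b = axial_symmetricD(1)[OF assms(2)]
  have "tetragonal_stiffness a b i j l m = tetragonal_stiffness a b j i l m" for i j l m
  proof -
    have "of_bool (j = i \<and> l = m) * a j l = of_bool (i = j \<and> l = m) * a i l"
      by (cases "i = j") simp_all
    then show ?thesis unfolding tetragonal_stiffness_def b[of j i] by (simp only: conj_commute add.commute)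
  qed
  moreover have "tetragonal_stiffness a b i j l m = tetragonal_stiffness a b l m i j" for i j l m
  proof -
    have "of_bool (l = m \<and> i = j) * a l i = of_bool (i = j \<and> l = m) * a i l"
      by (simp only: conj_commute a[of l i])
    moreover have "of_bool (l = i \<and> m = j) * b l m = of_bool (i = l \<and> j = m) * b i j"
      by (cases "i = l \<and> j = m") auto
    moreover have "of_bool (l = j \<and> m = i) * b l m = of_bool (i = m \<and> j = l) * b i j"
      by (cases "i = m \<and> j = l") (auto simp: b[of l m])
    ultimately show ?thesis unfolding tetragonal_stiffness_def distrib_right by (simp only:)
  qed
  ultimately have "strain_gradient_material (tetragonal_stiffness a b) (\<lambda>_ _ _ _ _. 0) (\<lambda>_ _ _ _ _ _. 0)"
    unfolding strain_gradient_material_def by blast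
  moreover have "invariant4 D4_Z2c (tetragonal_stiffness a b)"
    unfolding invariant4_def
  proof (intro ballI allI)
    fix Q and i j k l :: 3 assume "Q \<in> D4_Z2c"
    then obtain s p where sp: "Q = signed_perm s p" "\<And>i. s i = 1 \<or> s i = -1" "bij p" "p 3 = 3"
      using D4_Z2c_subset by (auto simp: signed_perms_def)
    have sq: "s i * s i = 1" "s i * (s i * x) = x" for i x using sp(2)[of i] by auto
    \<comment> \<open>Each of the three Kronecker patterns pairs the four indices, so every sign
      occurs squared; injectivity of \<open>p\<close> preserves the pattern.\<close>
    have "s i * s j * s k * s l * of_bool (i = j \<and> k = l) = of_bool (i = j \<and> k = l)"
      by (cases "i = j \<and> k = l") (auto simp: sq)
    moreover have "s i * s j * s k * s l * of_bool (i = k \<and> j = l) = of_bool (i = k \<and> j = l)"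
      by (cases "i = k \<and> j = l") (auto simp: sq mult_ac)
    moreover have "s i * s j * s k * s l * of_bool (i = l \<and> j = k) = of_bool (i = l \<and> j = k)"
      by (cases "i = l \<and> j = k") (auto simp: sq mult_ac)
    moreover have "p i = p j \<longleftrightarrow> i = j" for i j
      using sp(3) by (simp add: bij_is_inj inj_eq)
    moreover have "a (p i) (p k) = a i k" "b (p i) (p j) = b i j"
      using assms sp(3,4) by (simp_all add: axial_symmetricD(2))
    ultimately have "s i * s j * s k * s l * tetragonal_stiffness a b (p i) (p j) (p k) (p l) = tetragonal_stiffness a b i j k l"
      unfolding tetragonal_stiffness_def by (simp only: distrib_left distrib_right mult.assoc[symmetric])
    then show "(\<Sum>a'\<in>UNIV. \<Sum>b'\<in>UNIV. \<Sum>c\<in>UNIV. \<Sum>d\<in>UNIV.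
        Q $ i $ a' * Q $ j $ b' * Q $ k $ c * Q $ l $ d * tetragonal_stiffness a b a' b' c d) = tetragonal_stiffness a b i j k l"
      unfolding sp(1) signed_perm_sum4 .
  qed
  ultimately show ?thesis by (simp add: class_D4v_def invariant5_def invariant6_def)
qed

lemma polar_in_class: "(\<lambda>_ _ _ _. 0, polar_coupling, \<lambda>_ _ _ _ _ _. 0) \<in> class_D4v"
proof -
  have "strain_gradient_material (\<lambda>_ _ _ _. 0) polar_coupling (\<lambda>_ _ _ _ _ _. 0)"
    by (auto simp: strain_gradient_material_def polar_coupling_def)
  moreover have "invariant5 D4v polar_coupling"
    unfolding invariant5_def
  proof (intro ballI allI)
    fix Q and i j k l m :: 3 assume "Q \<in> D4v"
    then obtain s p where sp: "Q = signed_perm s p" "\<And>i. s i = 1 \<or> s i = -1" "bij p" "p 3 = 3" "s 3 = 1"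
      using D4v_subset by (auto simp: signed_perms_def)
    have sq: "s i * s i = 1" "s i * (s i * x) = x" for i x using sp(2)[of i] by auto
    have peq: "p i = p j \<longleftrightarrow> i = j" for i j
      using sp(3) by (simp add: bij_is_inj inj_eq)
    have p3: "p i = 3 \<longleftrightarrow> i = 3" "3 = p i \<longleftrightarrow> 3 = i" for i using peq[of i 3] sp(4) by auto
    let ?P = "i = j \<and> j = m \<and> i \<noteq> 3 \<and> (k = 3 \<and> l = i \<or> k = i \<and> l = 3)"
    have "s i * s j * s k * s l * s m * of_bool ?P = of_bool ?P"
      by (cases ?P) (auto simp: sq sp(5) mult_ac)
    then have "s i * s j * s k * s l * s m * polar_coupling (p i) (p j) (p k) (p l) (p m) = polar_coupling i j k l m"
      unfolding polar_coupling_def by (simp only: peq p3)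
    then show "(\<Sum>a\<in>UNIV. \<Sum>b\<in>UNIV. \<Sum>c\<in>UNIV. \<Sum>d\<in>UNIV. \<Sum>e\<in>UNIV.
        Q $ i $ a * Q $ j $ b * Q $ k $ c * Q $ l $ d * Q $ m $ e * polar_coupling a b c d e) = polar_coupling i j k l m"
      unfolding sp(1) signed_perm_sum5 .
  qed
  ultimately show ?thesis by (simp add: class_D4v_def invariant4_def invariant6_def)
qed

section \<open>Necessity\<close>

lemma sum_of_bool_mult:
  fixes f :: "'n::finite \<Rightarrow> real"
  shows "(\<Sum>m\<in>UNIV. of_bool (c = m) * f m) = f c"
proof -
  have "(\<Sum>m\<in>UNIV. of_bool (c = m) * f m) = (\<Sum>m\<in>UNIV. if c = m then f m else 0)"
    by (rule sum.cong) auto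
  then show ?thesis by simp
qed

text \<open>The Kronecker symbols collapse the double sum, and the two equal shear terms cancel the
  factor 1/2 in the strain.\<close>

lemma stress_tetragonal:
  "stress (tetragonal_stiffness a b) (\<lambda>_ _ _ _ _. 0) u i j x =
     of_bool (i = j) * (\<Sum>l\<in>UNIV. a i l * partial l (\<lambda>y. u y $ l) x) +
     b i j * (partial j (\<lambda>y. u y $ i) x + partial i (\<lambda>y. u y $ j) x)"
proof -
  let ?e = "\<lambda>l m. strain u l m x"
  have "stress (tetragonal_stiffness a b) (\<lambda>_ _ _ _ _. 0) u i j x =
      (\<Sum>l\<in>UNIV. \<Sum>m\<in>UNIV. of_bool (i = j) * (a i l * (of_bool (l = m) * ?e l m)) +
        b i j * (of_bool (i = l) * (of_bool (j = m) * ?e l m)) +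
        b i j * (of_bool (j = l) * (of_bool (i = m) * ?e l m)))"
    by (simp add: stress_def tetragonal_stiffness_def of_bool_conj algebra_simps)
  also have "\<dots> = of_bool (i = j) * (\<Sum>l\<in>UNIV. a i l * ?e l l) + b i j * ?e i j + b i j * ?e j i"
    by (simp only: sum.distrib sum_distrib_left[symmetric] sum_of_bool_mult)
  finally show ?thesis by (simp add: strain_def algebra_simps)
qed

lemma equilibrium_tetragonal:
  assumes "equilibrium \<Omega> (tetragonal_stiffness a b) (\<lambda>_ _ _ _ _. 0) (\<lambda>_ _ _ _ _ _. 0) u"
    and u: "\<And>i. smooth \<Omega> (\<lambda>y. u y $ i)" and "open \<Omega>" "x \<in> \<Omega>"
  shows "(\<Sum>l\<in>UNIV. a i l * partial i (partial l (\<lambda>y. u y $ l)) x) +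
    (\<Sum>j\<in>UNIV. b i j * (partial j (partial j (\<lambda>y. u y $ i)) x + partial j (partial i (\<lambda>y. u y $ j)) x)) = 0"
proof -
  note df = smooth_differentiable[OF smooth_partial[OF u] assms(3,4)]
  have "partial j (stress (tetragonal_stiffness a b) (\<lambda>_ _ _ _ _. 0) u i j) x =
     of_bool (i = j) * (\<Sum>l\<in>UNIV. a i l * partial i (partial l (\<lambda>y. u y $ l)) x) +
     b i j * (partial j (partial j (\<lambda>y. u y $ i)) x + partial j (partial i (\<lambda>y. u y $ j)) x)" for j
  proof -
    let ?S = "\<lambda>x. \<Sum>l\<in>UNIV. a i l * partial l (\<lambda>y. u y $ l) x"
    let ?B = "\<lambda>x. partial j (\<lambda>y. u y $ i) x + partial i (\<lambda>y. u y $ j) x"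
    have S: "?S differentiable at x" "?B differentiable at x"
      by (simp_all add: df differentiable_add)
    have "stress (tetragonal_stiffness a b) (\<lambda>_ _ _ _ _. 0) u i j = (\<lambda>x. of_bool (i = j) * ?S x + b i j * ?B x)"
      by (rule ext) (rule stress_tetragonal)
    then have "partial j (stress (tetragonal_stiffness a b) (\<lambda>_ _ _ _ _. 0) u i j) x =
        of_bool (i = j) * partial j ?S x + b i j * partial j ?B x"
      using S by (simp only: partial_add partial_cmult differentiable_mult differentiable_const)
    also have "partial j ?S x = (\<Sum>l\<in>UNIV. a i l * partial j (partial l (\<lambda>y. u y $ l)) x)"
      by (subst partial_sum) (auto intro!: sum.cong differentiable_mult differentiable_const df partial_cmult)
    also have "partial j ?B x = partial j (partial j (\<lambda>y. u y $ i)) x + partial j (partial i (\<lambda>y. u y $ j)) x"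
      by (intro partial_add df)
    finally show ?thesis by (cases "i = j") simp_all
  qed
  moreover have "hyper_stress (\<lambda>_ _ _ _ _. 0) (\<lambda>_ _ _ _ _ _. 0) u = (\<lambda>_ _ _ _. 0)"
    by (simp add: hyper_stress_def fun_eq_iff)
  moreover have "(\<Sum>j\<in>UNIV. partial j (stress (tetragonal_stiffness a b) (\<lambda>_ _ _ _ _. 0) u i j) x) -
      (\<Sum>j\<in>UNIV. \<Sum>k\<in>UNIV. partial k (partial j (hyper_stress (\<lambda>_ _ _ _ _. 0) (\<lambda>_ _ _ _ _ _. 0) u i j k)) x) = 0"
    using assms(1,4) unfolding equilibrium_def by blast
  ultimately show ?thesis by (simp add: sum.distrib sum_of_bool_mult)
qed

lemma hyper_stress_polar:
  "hyper_stress polar_coupling (\<lambda>_ _ _ _ _ _. 0) u i j k x =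
     of_bool (k \<noteq> 3 \<and> (i = 3 \<and> j = k \<or> i = k \<and> j = 3)) * partial k (\<lambda>y. u y $ k) x"
  using exhaust_3[of i] exhaust_3[of j] exhaust_3[of k]
  by (elim disjE) (simp_all add: hyper_stress_def polar_coupling_def sum_3 strain_def)

text \<open>The factor 2 comes from the two positions of the index 3 in the strain pair.\<close>

lemma stress_polar:
  "stress (\<lambda>_ _ _ _. 0) polar_coupling u i j x =
     of_bool (i = j \<and> i \<noteq> 3) * (2 * partial i (strain u i 3) x)"
proof -
  have "strain u 3 i = strain u i 3" by (simp add: strain_def fun_eq_iff)
  then show ?thesis
    using exhaust_3[of i] exhaust_3[of j]
    by (elim disjE) (simp_all add: stress_def polar_coupling_def sum_3)
qed

text \<open>Once the third partials of \<open>u y $ i\<close> are known to vanish, this equation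
  leaves only the pure third derivative of \<open>u y $ 3\<close> in direction
  \<open>i\<close>.\<close>

lemma equilibrium_polar:
  assumes "equilibrium \<Omega> (\<lambda>_ _ _ _. 0) polar_coupling (\<lambda>_ _ _ _ _ _. 0) u"
    and u: "\<And>i. smooth \<Omega> (\<lambda>y. u y $ i)" and "open \<Omega>" "x \<in> \<Omega>" "i \<noteq> 3"
  shows "partial i (partial i (partial 3 (\<lambda>y. u y $ i))) x + partial i (partial i (partial i (\<lambda>y. u y $ 3))) x
    = partial i (partial 3 (partial i (\<lambda>y. u y $ i))) x"
proof -
  note u1 = smooth_partial[OF u] and u2 = smooth_partial[OF smooth_partial[OF u]]
  note df = smooth_differentiable[OF _ \<open>open \<Omega>\<close>]
  have "strain u i 3 = (\<lambda>x. (1/2) * (partial 3 (\<lambda>y. u y $ i) x + partial i (\<lambda>y. u y $ 3) x))"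
    by (simp add: strain_def fun_eq_iff)
  then have "2 * partial i (strain u i 3) y =
      partial i (partial 3 (\<lambda>y. u y $ i)) y + partial i (partial i (\<lambda>y. u y $ 3)) y" if "y \<in> \<Omega>" for y
    using that by (simp only: partial_cmult partial_add df u1 differentiable_add) simp
  then have "partial i (\<lambda>y. 2 * partial i (strain u i 3) y) x = partial i (\<lambda>y.
      partial i (partial 3 (\<lambda>y. u y $ i)) y + partial i (partial i (\<lambda>y. u y $ 3)) y) x"
    using \<open>open \<Omega>\<close> \<open>x \<in> \<Omega>\<close> by (intro partial_cong)
  also have "\<dots> = partial i (partial i (partial 3 (\<lambda>y. u y $ i))) x + partial i (partial i (partial i (\<lambda>y. u y $ 3))) x"
    by (intro partial_add df u2 \<open>x \<in> \<Omega>\<close>)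
  finally have S: "partial i (\<lambda>y. 2 * partial i (strain u i 3) y) x = \<dots>" .
  have "stress (\<lambda>_ _ _ _. 0) polar_coupling u j k =
      (\<lambda>x. of_bool (j = k \<and> j \<noteq> 3) * (2 * partial j (strain u j 3) x))" for j k
    by (rule ext) (rule stress_polar)
  moreover have "hyper_stress polar_coupling (\<lambda>_ _ _ _ _ _. 0) u j k l =
      (\<lambda>x. of_bool (l \<noteq> 3 \<and> (j = 3 \<and> k = l \<or> j = l \<and> k = 3)) * partial l (\<lambda>y. u y $ l) x)" for j k l
    by (rule ext) (rule hyper_stress_polar)
  moreover have "i = 1 \<or> i = 2" using \<open>i \<noteq> 3\<close> exhaust_3 by blast
  ultimately have "partial i (\<lambda>y. 2 * partial i (strain u i 3) y) x =
      partial i (partial 3 (partial i (\<lambda>y. u y $ i))) x"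
    using assms(1,4) unfolding equilibrium_def by (auto simp: sum_3 forall_3)
  then show ?thesis using S by simp
qed

text \<open>A second partial vanishing on all of \<Omega> kills every third partial whose indices
  include the same pair. All six orders are listed so that they serve as rewrite rules.\<close>

lemma third_partials_zero:
  assumes f: "smooth \<Omega> f" and "open \<Omega>" "x \<in> \<Omega>"
    and zero: "\<And>y. y \<in> \<Omega> \<Longrightarrow> partial m (partial n f) y = 0"
  shows "partial k (partial m (partial n f)) x = 0" "partial k (partial n (partial m f)) x = 0"
    "partial m (partial k (partial n f)) x = 0" "partial n (partial k (partial m f)) x = 0"
    "partial m (partial n (partial k f)) x = 0" "partial n (partial m (partial k f)) x = 0"
proof -
  have zero': "partial n (partial m f) y = 0" if "y \<in> \<Omega>" for y
    using zero[OF that] partial_commute[OF f \<open>open \<Omega>\<close> that] by simp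
  have c: "partial k g x = 0" if "\<And>y. y \<in> \<Omega> \<Longrightarrow> g y = 0" for g
    using partial_cong[OF assms(2,3), of g "\<lambda>_. 0"] that by simp
  show kmn: "partial k (partial m (partial n f)) x = 0" "partial k (partial n (partial m f)) x = 0"
    by (intro c zero zero'; simp)+
  show mkn: "partial m (partial k (partial n f)) x = 0" "partial n (partial k (partial m f)) x = 0"
    using kmn partial_commute[OF smooth_partial[OF f] assms(2,3)] by simp_all
  have "partial m (partial n (partial k f)) x = partial m (partial k (partial n f)) x"
    "partial n (partial m (partial k f)) x = partial n (partial k (partial m f)) x"
    by (intro partial_cong[OF assms(2,3)] partial_commute[OF f assms(2)]; simp)+
  then show "partial m (partial n (partial k f)) x = 0" "partial n (partial m (partial k f)) x = 0"
    by (simp_all add: mkn)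
qed

text \<open>Bijectivity is replaced by two equivalences that simplify the index conditions of the
  0-1 test matrices directly.\<close>

lemma axial_symmetricI:
  assumes "\<And>i j. a i j = a j i"
    and "\<And>p i j. (\<And>i j. p i = p j \<longleftrightarrow> i = j) \<Longrightarrow> (\<And>i. p i = 3 \<longleftrightarrow> i = 3) \<Longrightarrow> a (p i) (p j) = a i j"
  shows "axial_symmetric a"
  unfolding axial_symmetric_def
proof (intro conjI allI impI)
  fix p :: "3 \<Rightarrow> 3" and i j assume p: "bij p" "p 3 = 3"
  have eq: "p i = p j \<longleftrightarrow> i = j" for i j
    using p(1) by (simp add: bij_is_inj inj_eq)
  show "a (p i) (p j) = a i j"
    by (rule assms(2)) (use eq eq[of _ 3] p(2) in simp_all)
qed (rule assms(1))

lemma universal_second_partials: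
  assumes univ: "universal class_D4v \<Omega> u"
    and u: "\<And>i. smooth \<Omega> (\<lambda>y. u y $ i)" and "open \<Omega>" "x \<in> \<Omega>"
  defines "D \<equiv> \<lambda>k i j. partial i (partial j (\<lambda>y. u y $ k)) x"
  shows "D 1 1 1 = 0" "D 1 2 2 = 0" "D 1 3 3 = 0" "D 1 1 2 = 0"
    and "D 2 1 1 = 0" "D 2 2 2 = 0" "D 2 3 3 = 0" "D 2 1 2 = 0"
    and "D 3 1 3 = 0" "D 3 2 3 = 0" "D 3 3 3 = 0"
    and "D 2 2 3 = - D 1 1 3" "D 3 2 2 = - D 3 1 1"
proof -
  have E: "(\<Sum>l\<in>UNIV. a i l * D l i l) + (\<Sum>j\<in>UNIV. b i j * (D i j j + D j j i)) = 0"
    if "axial_symmetric a" "axial_symmetric b" for a b i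
    unfolding D_def using univ tetragonal_stiffness_in_class[OF that]
    by (intro equilibrium_tetragonal[OF _ u assms(3,4)]) (auto simp: universal_def)
  have sym: "D k i j = D k j i" for k i j
    unfolding D_def by (rule partial_commute[OF u assms(3,4)])
  note s = sym[of _ 2 1] sym[of _ 3 1] sym[of _ 3 2]
  \<comment> \<open>Six independent tests follow. \<open>E1\<close> to \<open>E4\<close> vary
    \<open>a\<close> with \<open>b\<close> zero, and \<open>E5\<close> and \<open>E6\<close> vary
    \<open>b\<close> with \<open>a\<close> zero; each 0-1 matrix isolates one group of second
    partials.\<close>
  have zero: "axial_symmetric (\<lambda>_ _. 0)" by (simp add: axial_symmetric_def)
  have "axial_symmetric (\<lambda>i l. of_bool (i = l \<and> i \<noteq> 3))"
    by (rule axial_symmetricI) auto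
  note E1 = E[OF this zero, unfolded sum_3]
  have "axial_symmetric (\<lambda>i l. of_bool (i \<noteq> l \<and> i \<noteq> 3 \<and> l \<noteq> 3))"
    by (rule axial_symmetricI) auto
  note E2 = E[OF this zero, unfolded sum_3] and E5 = E[OF zero this, unfolded sum_3]
  have "axial_symmetric (\<lambda>i l. of_bool ((i = 3) \<noteq> (l = 3)))"
    by (rule axial_symmetricI) auto
  note E3 = E[OF this zero, unfolded sum_3] and E6 = E[OF zero this, unfolded sum_3]
  have "axial_symmetric (\<lambda>i l. of_bool (i = 3 \<and> l = 3))"
    by (rule axial_symmetricI) auto
  note E4 = E[OF this zero, unfolded sum_3]
  show D: "D 1 1 1 = 0" "D 1 1 2 = 0" "D 2 2 2 = 0" "D 2 1 2 = 0"
    "D 3 1 3 = 0" "D 3 2 3 = 0" "D 3 3 3 = 0" "D 2 2 3 = - D 1 1 3"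
    using E1[of 1] E1[of 2] E2[of 1] E2[of 2] E3[of 1] E3[of 2] E3[of 3] E4[of 3]
    by (simp_all add: s)
  \<comment> \<open>Each shear equation pairs a Laplacian-type term with a mixed term. The mixed
    terms are already zero or cancel, the latter giving harmonicity of the third component in the
    plane.\<close>
  show "D 1 2 2 = 0" "D 1 3 3 = 0" "D 2 1 1 = 0" "D 2 3 3 = 0" "D 3 2 2 = - D 3 1 1"
    using E5[of 1] E5[of 2] E6[of 1] E6[of 2] E6[of 3] D
    by (simp_all add: s)
qed

lemma universal_third_partials:
  assumes univ: "universal class_D4v \<Omega> u"
    and u: "\<And>i. smooth \<Omega> (\<lambda>y. u y $ i)" and "open \<Omega>" "x \<in> \<Omega>"
  shows "partial i (partial j (partial k (\<lambda>y. u y $ l))) x = 0"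
proof -
  note second = universal_second_partials[OF univ u assms(3)]
  note T = third_partials_zero[OF u assms(3,4)]
  \<comment> \<open>Three indices either repeat one or are 1, 2, 3 in some order. Hence the
    vanishing pairs 11, 22, 33 and 12 cover all cases, for the second component as well.\<close>
  have T1: "partial i (partial j (partial k (\<lambda>y. u y $ 1))) x = 0" for i j k
    using exhaust_3[of i] exhaust_3[of j] exhaust_3[of k]
    by (elim disjE) (simp_all add: T[OF second(1)] T[OF second(2)] T[OF second(3)] T[OF second(4)])
  have T2: "partial i (partial j (partial k (\<lambda>y. u y $ 2))) x = 0" for i j k
    using exhaust_3[of i] exhaust_3[of j] exhaust_3[of k]
    by (elim disjE) (simp_all add: T[OF second(5)] T[OF second(6)] T[OF second(7)] T[OF second(8)])
  let ?g = "\<lambda>y. u y $ 3"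
  have "partial i (partial i (partial i ?g)) x = 0" if "i \<noteq> 3" for i
    using equilibrium_polar[OF _ u assms(3,4) that] univ polar_in_class T1 T2 that exhaust_3[of i]
    by (auto simp: universal_def)
  then have g: "partial 1 (partial 1 (partial 1 ?g)) x = 0" "partial 2 (partial 2 (partial 2 ?g)) x = 0"
    by simp_all
  \<comment> \<open>Differentiating harmonicity reduces the mixed third derivatives in the plane to
    the pure ones in \<open>g\<close>.\<close>
  have harm: "partial i (partial 2 (partial 2 ?g)) x = - partial i (partial 1 (partial 1 ?g)) x" for i
  proof -
    have "partial i (partial 2 (partial 2 ?g)) x = partial i (\<lambda>y. (-1) * partial 1 (partial 1 ?g) y) x"
      by (rule partial_cong[OF assms(3,4)]) (simp add: second(13))
    also have "\<dots> = (-1) * partial i (partial 1 (partial 1 ?g)) x"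
      by (rule partial_cmult) (rule smooth_differentiable[OF smooth_partial[OF smooth_partial[OF u]] assms(3,4)])
    finally show ?thesis by simp
  qed
  have inner: "partial i (partial 2 (partial 1 ?g)) x = partial i (partial 1 (partial 2 ?g)) x" for i
    by (rule partial_cong[OF assms(3,4)]) (rule partial_commute[OF u assms(3)])
  have outer: "partial 2 (partial 1 (partial j ?g)) x = partial 1 (partial 2 (partial j ?g)) x" for j
    by (rule partial_commute[OF smooth_partial[OF u] assms(3,4)])
  \<comment> \<open>If an index is 3, one of the vanishing pairs 13, 23, 33 occurs. The remaining
    triples from 1 and 2 are brought to one order by \<open>inner\<close> and
    \<open>outer\<close>.\<close>
  have T3: "partial i (partial j (partial k ?g)) x = 0" for i j k
    using exhaust_3[of i] exhaust_3[of j] exhaust_3[of k] g harm[of 1] harm[of 2]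
      inner[of 1] inner[of 2] outer[of 1] outer[of 2]
    by (elim disjE) (simp_all add: T[OF second(9)] T[OF second(10)] T[OF second(11)])
  show ?thesis using exhaust_3[of l] T1 T2 T3 by auto
qed

section \<open>Sufficiency\<close>

lemma strain_quadratic:
  assumes u: "\<And>y i. y \<in> \<Omega> \<Longrightarrow> u y $ i = quadratic (d i) (b i) (q i) y"
    and q: "\<And>i m n. q i m n = q i n m" and "open \<Omega>" "x \<in> \<Omega>"
  shows "strain u l m x = (b l m + b m l) / 2 + (\<Sum>n\<in>UNIV. (q l m n + q m l n) / 2 * x $ n)"
proof -
  have "partial m (\<lambda>y. u y $ l) x = b l m + (\<Sum>n\<in>UNIV. q l m n * x $ n)" for l m
    using partial_cong[OF assms(3,4) u] partial_quadratic[of "q l", OF q] by simp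
  then show ?thesis by (simp add: strain_def sum_3 field_simps)
qed

text \<open>The strain is affine and its gradient constant, so both stresses are affine. The second
  derivatives of the hyper-stress vanish, and \<open>M\<close> adds only a constant to the stress,
  which leaves the condition on \<open>C\<close>.\<close>

lemma equilibrium_quadratic:
  assumes u: "\<And>y i. y \<in> \<Omega> \<Longrightarrow> u y $ i = quadratic (d i) (b i) (q i) y"
    and q: "\<And>i m n. q i m n = q i n m" and \<Omega>: "open \<Omega>"
    and C: "\<And>i. (\<Sum>j\<in>UNIV. \<Sum>l\<in>UNIV. \<Sum>m\<in>UNIV. C i j l m * ((q l m j + q m l j) / 2)) = 0"
  shows "equilibrium \<Omega> C M A u"
  unfolding equilibrium_def
proof (intro ballI allI)
  fix x i assume x: "x \<in> \<Omega>"
  define E where "E l m n = (q l m n + q m l n) / 2" for l m n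
  define K where "K l m = (b l m + b m l) / 2" for l m
  have strain: "strain u l m y = K l m + (\<Sum>n\<in>UNIV. E l m n * y $ n)" if "y \<in> \<Omega>" for l m y
    unfolding K_def E_def using strain_quadratic[OF u q \<Omega> that] .
  have grad: "partial n (strain u l m) y = E l m n" if "y \<in> \<Omega>" for l m n y
    by (rule partial_affine[OF \<Omega> that strain])
  \<comment> \<open>The term \<open>k\<close> absorbs the constant contribution of the strain
    gradient, so that one identity serves both stresses.\<close>
  have affine: "(\<Sum>l\<in>UNIV. \<Sum>m\<in>UNIV. c l m * strain u l m y) + k =
      ((\<Sum>l\<in>UNIV. \<Sum>m\<in>UNIV. c l m * K l m) + k) + (\<Sum>n\<in>UNIV. (\<Sum>l\<in>UNIV. \<Sum>m\<in>UNIV. c l m * E l m n) * y $ n)"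
    if "y \<in> \<Omega>" for c k y
    unfolding sum_3 strain[OF that] by (simp add: algebra_simps)
  have "partial j (stress C M u i j) x = (\<Sum>l\<in>UNIV. \<Sum>m\<in>UNIV. C i j l m * E l m j)" for j
    by (rule partial_affine[OF \<Omega> x, of _ "(\<Sum>l\<in>UNIV. \<Sum>m\<in>UNIV. C i j l m * K l m) +
          (\<Sum>l\<in>UNIV. \<Sum>m\<in>UNIV. \<Sum>n\<in>UNIV. M i j l m n * E l m n)"])
      (simp only: stress_def grad affine)
  moreover have "partial k (partial j (hyper_stress M A u i j k)) x = 0" for j k
  proof -
    have "partial j (hyper_stress M A u i j k) y = (\<Sum>l\<in>UNIV. \<Sum>m\<in>UNIV. M l m i j k * E l m j)"
      if "y \<in> \<Omega>" for y
      by (rule partial_affine[OF \<Omega> that, of _ "(\<Sum>l\<in>UNIV. \<Sum>m\<in>UNIV. M l m i j k * K l m) +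
            (\<Sum>l\<in>UNIV. \<Sum>m\<in>UNIV. \<Sum>n\<in>UNIV. A i j k l m n * E l m n)"])
        (simp only: hyper_stress_def grad affine[where c = "\<lambda>l m. M l m i j k"])
    from partial_cong[OF \<Omega> x this] show ?thesis by (simp only: partial_const)
  qed
  ultimately show "(\<Sum>j\<in>UNIV. partial j (stress C M u i j) x) -
      (\<Sum>j\<in>UNIV. \<Sum>k\<in>UNIV. partial k (partial j (hyper_stress M A u i j k)) x) = 0"
    using C[of i] by (simp add: E_def)
qed

section \<open>Cancellation in the divergence of the stress\<close>

lemma invariant4_signed_perm:
  assumes "invariant4 G T" "signed_perm s p \<in> G"
  shows "s i * s j * s k * s l * T (p i) (p j) (p k) (p l) = T i j k l"
  using bspec[OF assms(1)[unfolded invariant4_def] assms(2)] unfolding signed_perm_sum4 by simp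

text \<open>Every nonzero \<open>q\<close> has exactly one 3 among its three indices. For
  \<open>i\<close> equal to 1 or 2 the matching entry of \<open>C\<close> then has a single index 3
  and vanishes. For \<open>i = 3\<close> it has two, and the contributions of axes 1 and 2 cancel by
  the quarter turn and \<open>q4\<close>.\<close>

lemma stiffness_divergence_zero:
  assumes C: "invariant4 D4_Z2c C"
    and sym: "\<And>i j l m. C i j l m = C j i l m" "\<And>i j l m. C i j l m = C l m i j"
  assumes q: "\<And>i m n. q i m n = q i n m"
    and q1: "q 1 1 1 = 0" "q 1 2 2 = 0" "q 1 3 3 = 0" "q 1 1 2 = 0"
    and q2: "q 2 1 1 = 0" "q 2 2 2 = 0" "q 2 3 3 = 0" "q 2 1 2 = 0"
    and q3: "q 3 1 3 = 0" "q 3 2 3 = 0" "q 3 3 3 = 0"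
    and q4: "q 2 2 3 = - q 1 1 3" "q 3 2 2 = - q 3 1 1"
  shows "(\<Sum>j\<in>UNIV. \<Sum>l\<in>UNIV. \<Sum>m\<in>UNIV. C i j l m * ((q l m j + q m l j) / 2)) = (0::real)"
proof -
  note rot = invariant4_signed_perm[OF C rot3_in_D4_Z2c[unfolded rot3_signed_perm], unfolded signs_def swap12_def]
  note flip = invariant4_signed_perm[OF C rot1_in_D4_Z2c[unfolded rot1_signed_perm], unfolded signs_def]
  have minor: "C i j l m = C i j m l" for i j l m using sym by metis
  \<comment> \<open>Two quarter turns reverse the sign of entries with an odd number of indices 3.\<close>
  have odd: "C 1 3 1 1 = 0" "C 1 3 2 2 = 0" "C 1 3 1 2 = 0" "C 1 2 1 3 = 0" "C 1 2 2 3 = 0"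
      "C 1 1 1 3 = 0" "C 1 1 2 3 = 0" "C 2 3 1 1 = 0" "C 2 3 2 2 = 0" "C 2 3 1 2 = 0"
      "C 2 2 1 3 = 0" "C 2 2 2 3 = 0"
    using rot[of 1 3 1 1] rot[of 2 3 2 2] rot[of 1 3 2 2] rot[of 2 3 1 1] 
      rot[of 1 3 1 2] rot[of 2 3 2 1] minor[of 2 3 1 2] minor[of 2 3 2 1]  minor[of 1 3 1 2] sym(2)
    by (simp_all)
  \<comment> \<open>The half turn \<open>flip\<close> reverses indices 2 and 3 and kills the first
    two entries; the quarter turn exchanges axes 1 and 2 in the others.\<close>
  have even: "C 3 3 1 2 = 0" "C 3 1 2 3 = 0" "C 3 3 2 2 = C 3 3 1 1" "C 3 2 2 3 = C 3 1 1 3"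
    using flip[of 3 3 1 2] flip[of 3 1 2 3] rot[of 3 3 1 1] rot[of 3 1 1 3] by simp_all
  have qs: "q i 2 1 = q i 1 2" "q i 3 1 = q i 1 3" "q i 3 2 = q i 2 3" for i by (rule q)+
  have Cs: "C i j 2 1 = C i j 1 2" "C i j 3 1 = C i j 1 3" "C i j 3 2 = C i j 2 3" for i j by (rule minor)+
  have Cs': "C 2 1 l m = C 1 2 l m" for l m by (rule sym(1))
  have Cs3: "C 3 2 1 3 = 0" using flip[of 3 2 1 3] by simp
  show ?thesis
    using exhaust_3[of i]
    by (elim disjE) (simp_all add: sum_3 q1 q2 q3 q4 qs Cs Cs' Cs3 odd even algebra_simps)
qed

section \<open>The characterization of universal displacements\<close>

theorem proposition3p18:
  fixes \<Omega> :: "(real^3) set" and u :: "real^3 \<Rightarrow> real^3"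
  assumes "open \<Omega>" and "convex \<Omega>" and "\<Omega> \<noteq> {}"
    and "displacement_field \<Omega> u"
  shows "universal class_D4v \<Omega> u \<longleftrightarrow>
    (\<exists>v w :: real^3 \<Rightarrow> real^3.
       homogeneous_field \<Omega> v \<and>
       (\<exists>c1 c2 c3 d1 d2 d3 d4 d5 :: real.
          let g = (\<lambda>x1 x2 :: real. d1 + d2 * x1 + d3 * x2 + d4 * x1 * x2 + d5 * (x2^2 - x1^2))
          in \<forall>x\<in>\<Omega>. w x = vector [c1 * x$2 * x$3 + c2 * x$1 * x$3,
                                  - c2 * x$2 * x$3 + c3 * x$1 * x$3,
                                  g (x$1) (x$2)]) \<and>
       (\<forall>x\<in>\<Omega>. u x = v x + w x))"
    (is "_ \<longleftrightarrow> ?rhs")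
proof
  assume univ: "universal class_D4v \<Omega> u"
  have u: "smooth \<Omega> (\<lambda>x. u x $ i)" for i
    using assms(4) by (simp add: displacement_field_def smooth_def)
  obtain x0 where x0: "x0 \<in> \<Omega>" using \<open>\<Omega> \<noteq> {}\<close> by blast
  define q where "q i m n = partial m (partial n (\<lambda>x. u x $ i)) x0" for i m n
  have "\<exists>d b. \<forall>x\<in>\<Omega>. u x $ i = quadratic d b (q i) x" for i
    unfolding q_def
    by (rule quadratic_if_third_partials_zero[OF u assms(1,2) x0
        universal_third_partials[OF univ u assms(1)]]) auto
  then obtain d b where ub: "\<And>i x. x \<in> \<Omega> \<Longrightarrow> u x $ i = quadratic (d i) (b i) (q i) x"
    by metis
  note second = universal_second_partials[OF univ u assms(1) x0, folded q_def]
  have sym: "q i 2 1 = q i 1 2" "q i 3 1 = q i 1 3" "q i 3 2 = q i 2 3" for i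
    unfolding q_def by (rule partial_commute[OF u assms(1) x0])+
  \<comment> \<open>The constants are entries of the Hessians at \<open>x0\<close>. The affine part
    goes into \<open>?v\<close>, so \<open>d1\<close>, \<open>d2\<close>, \<open>d3\<close> are 0,
    written out to match the form of \<open>g\<close> by reflexivity. The last coefficient combines
    \<open>q 3 2 2 = - q 3 1 1\<close> with the factor 1/2 in \<open>quadratic\<close>.\<close>
  let ?w = "\<lambda>x. vector [q 1 2 3 * x$2 * x$3 + q 1 1 3 * x$1 * x$3,
       - q 1 1 3 * x$2 * x$3 + q 2 1 3 * x$1 * x$3,
       0 + 0 * x$1 + 0 * x$2 + q 3 1 2 * x$1 * x$2 + (- q 3 1 1 / 2) * ((x$2)^2 - (x$1)^2)] :: real^3"
  let ?v = "\<lambda>x. (\<chi> i j. b i j) *v x + (\<chi> i. d i)"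
  have "homogeneous_field \<Omega> ?v" unfolding homogeneous_field_def by blast
  moreover have "\<exists>c1 c2 c3 d1 d2 d3 d4 d5 :: real.
          let g = (\<lambda>x1 x2 :: real. d1 + d2 * x1 + d3 * x2 + d4 * x1 * x2 + d5 * (x2^2 - x1^2))
          in \<forall>x\<in>\<Omega>. ?w x = vector [c1 * x$2 * x$3 + c2 * x$1 * x$3,
                                  - c2 * x$2 * x$3 + c3 * x$1 * x$3,
                                  g (x$1) (x$2)]"
    unfolding Let_def by (intro exI ballI) (rule refl)
  moreover have "\<forall>x\<in>\<Omega>. u x = ?v x + ?w x"
    by (simp add: vec_eq_iff forall_3 ub quadratic_def sum_3 matrix_vector_mult_def sym second
        power2_eq_square field_simps)
  ultimately show ?rhs by (intro exI[of _ ?v] exI[of _ ?w] conjI)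
next
  assume ?rhs
  then obtain v w H h c1 c2 c3 d1 d2 d3 d4 d5 where
      v: "\<And>x. x \<in> \<Omega> \<Longrightarrow> v x = H *v x + h"
    and w: "\<And>x. x \<in> \<Omega> \<Longrightarrow> w x = vector [c1 * x$2 * x$3 + c2 * x$1 * x$3,
       - c2 * x$2 * x$3 + c3 * x$1 * x$3,
       d1 + d2 * x$1 + d3 * x$2 + d4 * x$1 * x$2 + d5 * ((x$2)^2 - (x$1)^2)]"
    and uvw: "\<And>x. x \<in> \<Omega> \<Longrightarrow> u x = v x + w x"
    unfolding homogeneous_field_def Let_def by blast
  \<comment> \<open>The Hessians of the three components of \<open>w\<close>, as nested vectors
    whose entries evaluate by simplification.\<close>
  define Q :: "real^3^3^3" where "Q = vector
     [vector [vector [0, 0, c2], vector [0, 0, c1], vector [c2, c1, 0]],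
      vector [vector [0, 0, c3], vector [0, 0, - c2], vector [c3, - c2, 0]],
      vector [vector [- 2 * d5, d4, 0], vector [d4, 2 * d5, 0], vector [0, 0, 0]]]"
  define q where "q i m n = Q $ i $ m $ n" for i m n
  \<comment> \<open>The affine terms of \<open>g\<close> are absorbed into the homogeneous
    part.\<close>
  define d where "d i = h $ i + of_bool (i = 3) * d1" for i
  define b where "b i m = H $ i $ m + of_bool (i = 3 \<and> m = 1) * d2 + of_bool (i = 3 \<and> m = 2) * d3" for i m
  have "\<forall>i. u x $ i = quadratic (d i) (b i) (q i) x" if "x \<in> \<Omega>" for x
    unfolding uvw[OF that] v[OF that] w[OF that] forall_3
    by (simp add: quadratic_def sum_3 d_def b_def q_def Q_def matrix_vector_mult_def
        power2_eq_square field_simps)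
  moreover have "\<forall>i m n. q i m n = q i n m"
    unfolding forall_3 by (simp add: q_def Q_def)
  ultimately have "equilibrium \<Omega> C M A u" if "(C, M, A) \<in> class_D4v" for C M A
    using that assms(1)
    by (intro equilibrium_quadratic[where q = q] stiffness_divergence_zero)
      (auto simp: class_D4v_def strain_gradient_material_def q_def Q_def)
  then show "universal class_D4v \<Omega> u" by (auto simp: universal_def)
qed

end
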